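(* Let $\mathcal{F}\subseteq\mathbb{C}^{N_t\times N}$ be the feasible set of one of the hardware schemes (S1)–(S5) described in the context, with associated map $\boldsymbol{P}_{\mathcal{F}}$. Let $\boldsymbol{F}_{opt}=\boldsymbol{V}\boldsymbol{\Phi}\boldsymbol{T}$ ($\boldsymbol{T}$ unitary) be the optimal fully-digital precoder described in the context, and assume that the diagonal matrix $\boldsymbol{\Phi}$ has positive values on its diagonal. Let $\tilde{\boldsymbol{F}}=\boldsymbol{F}_{RF}\boldsymbol{F}_{BB}$ be the hybrid precoder produced by the algorithm MaGiQ (defined in the context) for the input fully-digital precoder $\boldsymbol{V}\boldsymbol{\Phi}$, where the matrices $\boldsymbol{F}_{RF}$ computed by the algorithm are assumed to have full column rank. If $\boldsymbol{V}\boldsymbol{\Psi}\in\mathcal{F}$ for some diagonal, positive definite matrix $\boldsymbol{\Psi}\in\mathbb{R}^{N\times N}$, then $$\tilde{\boldsymbol{F}}=\boldsymbol{V}\boldsymbol{\Phi}.$$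
   Context: $N_t\ge N\ge 1$ are integers ($N_t$ transmit antennas, $N=N_{RF}^t=N_s$ RF chains and data streams). $\boldsymbol{X}^{*}$ is the conjugate transpose and $\Vert\cdot\Vert_F$ the Frobenius norm. **Optimal fully-digital precoder.** Let $\tilde{\boldsymbol{H}}\in\mathbb{C}^{M\times N_t}$ and let $\tilde{\boldsymbol{R}}\in\mathbb{C}^{M\times M}$ be Hermitian positive definite. $\boldsymbol{V}\in\mathbb{C}^{N_t\times N}$ is a matrix whose columns are the first $N$ eigenvectors (orthonormal, corresponding to the $N$ largest eigenvalues) of $\tilde{\boldsymbol{H}}^{*}\tilde{\boldsymbol{R}}^{-1}\tilde{\boldsymbol{H}}$, and $\boldsymbol{\Phi}$ is an $N\times N$ diagonal matrix of non-negative power-allocation weights such that, for every $N\times N$ unitary $\boldsymbol{T}$, the matrix $\boldsymbol{F}_{opt}=\boldsymbol{V}\boldsymbol{\Phi}\boldsymbol{T}$ maximizes $\mathrm{tr}\big(\tilde{\boldsymbol{H}}\boldsymbol{F}\boldsymbol{F}^{*}\tilde{\boldsymbol{H}}^{*}[\tilde{\boldsymbol{H}}\boldsymbol{F}\boldsymbol{F}^{*}\tilde{\boldsymbol{H}}^{*}+\tilde{\boldsymbol{R}}]^{-1}\big)$ over all $\boldsymbol{F}\in\mathbb{C}^{N_t\times N}$ with $\Vert\boldsymbol{F}\Vert_F^2\le N$. **Feasible sets and maps $\boldsymbol{P}_{\mathcal{F}}:\mathbb{C}^{N_t\times N}\to\mathcal{F}$.** For a complex number $a\neq 0$ let $\mathrm{ph}(a)=a/|a|$,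 and let $\mathrm{ph}(0)$ be any fixed unit-modulus number. Let $w_{ij}$ be the entries and $\boldsymbol{w}_j$ the columns of $\boldsymbol{W}$, and let $\Vert\cdot\Vert_0$ be the number of nonzero entries. - (S1) $\mathcal{F}=\{\boldsymbol{W}: |w_{ij}|\in\{0,1\}\}$; $[\boldsymbol{P}_{\mathcal{F}}(\boldsymbol{A})]_{il}=\mathrm{ph}(a_{il})$ if $|a_{il}|\ge \frac12$, and $0$ otherwise. - (S2) $\mathcal{F}=\{\boldsymbol{W}: |w_{ij}|=1\}$; $[\boldsymbol{P}_{\mathcal{F}}(\boldsymbol{A})]_{il}=\mathrm{ph}(a_{il})$. - (S3) $\mathcal{F}=\{\boldsymbol{W}: w_{ij}\in\{0,1\},\ \Vert\boldsymbol{w}_j\Vert_0=1\}$; $\boldsymbol{P}_{\mathcal{F}}(\boldsymbol{A})$ has, in each column, a $1$ at the position of the entry of largest absolute value in that column of $\boldsymbol{A}$ and $0$ elsewhere. - (S4) For given index sets $\mathcal{S}_j\subseteq\{1,\dots,N_t\}$ of size $G$, $j=1,\dots,N$: $\mathcal{F}=\{\boldsymbol{W}: |w_{ij}|=1 \text{ for } i\in\mathcal{S}_j,\ w_{ij}=0\text{ for } i\notin\mathcal{S}_j\}$; $[\boldsymbol{P}_{\mathcal{F}}(\boldsymbol{A})]_{ij}=\mathrm{ph}(a_{ij})$ for $i\in\mathcal{S}_j$ and $0$ otherwise. - (S5) For a given $1\le G\le N_t$: $\mathcal{F}=\{\boldsymbol{W}: |w_{ij}|\in\{0,1\},\ \Vert\boldsymbol{w}_j\Vert_0=G\}$;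 $\boldsymbol{P}_{\mathcal{F}}(\boldsymbol{A})$ applies $\mathrm{ph}$ to the $G$ entries of largest absolute value in each column of $\boldsymbol{A}$ and sets all others to $0$. Ties in (S3) and (S5) are broken arbitrarily. **Algorithm MaGiQ** (input $\boldsymbol{V}\boldsymbol{\Phi}$). Initialize $\boldsymbol{T}=\boldsymbol{I}_N$. Repeat the following iteration: (1) set $\boldsymbol{F}_{RF}=\boldsymbol{P}_{\mathcal{F}}(\boldsymbol{V}\boldsymbol{\Phi}\boldsymbol{T})$; (2) compute a singular value decomposition $\boldsymbol{F}_{RF}^{*}\boldsymbol{V}\boldsymbol{\Phi}=\tilde{\boldsymbol{U}}\boldsymbol{\Lambda}\tilde{\boldsymbol{V}}^{*}$; (3) set $\boldsymbol{T}=\tilde{\boldsymbol{V}}\tilde{\boldsymbol{U}}^{*}$. The loop is stopped after some number $k\ge1$ of iterations (when $\Vert\boldsymbol{V}\boldsymbol{\Phi}\boldsymbol{T}-\boldsymbol{F}_{RF}\Vert_F^2$ falls below a threshold or when $\boldsymbol{F}_{RF},\boldsymbol{T}$ have converged). Finally set $\boldsymbol{F}_{BB}=[\boldsymbol{F}_{RF}^{*}\boldsymbol{F}_{RF}]^{-1}\boldsymbol{F}_{RF}^{*}\boldsymbol{V}\boldsymbol{\Phi}\boldsymbol{T}$; the hybrid precoder produced is $\tilde{\boldsymbol{F}}=\boldsymbol{F}_{RF}\boldsymbol{F}_{BB}$. The statement is for any such run (any stopping iteration $k\ge1$, any choice of singular value decompositions). *)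

theory Defs
  imports "HOL-Analysis.Analysis"
begin

text \<open>
  A matrix with rows indexed by \<open>'m\<close> and columns indexed by \<open>'n\<close> has type \<^typ>\<open>complex^'n^'m\<close>.
  The library norm on this type is the Frobenius norm.
\<close>

definition ctranspose :: "complex^'n^'m \<Rightarrow> complex^'m^'n" where
  "ctranspose A = (\<chi> i j. cnj (A $ j $ i))"

definition cmat :: "real^'n^'m \<Rightarrow> complex^'n^'m" where
  "cmat A = map_matrix complex_of_real A"

definition unitary :: "complex^'n^'n \<Rightarrow> bool" where
  "unitary U \<longleftrightarrow> ctranspose U ** U = mat 1 \<and> U ** ctranspose U = mat 1"

definition diagonal :: "'a::zero^'n^'n \<Rightarrow> bool" where
  "diagonal D \<longleftrightarrow> (\<forall>i j. i \<noteq> j \<longrightarrow> D $ i $ j = 0)"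

definition posdef :: "complex^'n^'n \<Rightarrow> bool" where
  "posdef A \<longleftrightarrow> ctranspose A = A \<and>
     (\<forall>x. x \<noteq> 0 \<longrightarrow> 0 < Re (\<Sum>i\<in>UNIV. cnj (x $ i) * (A *v x) $ i))"

definition svd :: "complex^'n^'n \<Rightarrow> complex^'n^'n \<Rightarrow> real^'n^'n \<Rightarrow> complex^'n^'n \<Rightarrow> bool" where
  "svd A U L W \<longleftrightarrow> unitary U \<and> unitary W \<and> diagonal L \<and> (\<forall>i. 0 \<le> L $ i $ i) \<and>
     A = U ** cmat L ** ctranspose W"

text \<open>
  The columns of \<open>V\<close> are part of an orthonormal eigenbasis (the columns of \<open>U\<close>) and belong to the
  \<open>CARD('n)\<close> largest eigenvalues, counted with multiplicity. The index type \<open>'n\<close> carries no order,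
  so the columns of \<open>V\<close> may list these eigenvectors in any order.
\<close>

definition leading_eigenvectors :: "complex^'m^'m \<Rightarrow> complex^'n^'m \<Rightarrow> bool" where
  "leading_eigenvectors A V \<longleftrightarrow>
     (\<exists>(U :: complex^'m^'m) (ev :: 'm \<Rightarrow> real) (\<sigma> :: 'n \<Rightarrow> 'm).
        unitary U \<and>
        (\<forall>i. A *v column i U = complex_of_real (ev i) *s column i U) \<and>
        inj \<sigma> \<and>
        (\<forall>j. column j V = column (\<sigma> j) U) \<and>
        (\<forall>j. \<forall>i. i \<notin> range \<sigma> \<longrightarrow> ev i \<le> ev (\<sigma> j)))"

text \<open>
  For \<open>R\<close> positive definite the trace below is a real number, so taking the real part only serves
  to obtain an ordered type.
\<close>

definition precoder_objective ::
  "complex^'t^'m \<Rightarrow> complex^'m^'m \<Rightarrow> complex^'n^'t \<Rightarrow> real" where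
  "precoder_objective H R F =
     (let S = H ** F ** ctranspose F ** ctranspose H
      in Re (trace (S ** matrix_inv (S + R))))"

definition optimal_precoder ::
  "complex^'t^'m \<Rightarrow> complex^'m^'m \<Rightarrow> complex^'n^'t \<Rightarrow> bool" where
  "optimal_precoder H R F \<longleftrightarrow>
     (norm F)\<^sup>2 \<le> real CARD('n) \<and>
     (\<forall>F' :: complex^'n^'t. (norm F')\<^sup>2 \<le> real CARD('n) \<longrightarrow>
        precoder_objective H R F' \<le> precoder_objective H R F)"

definition optimal_digital_factors ::
  "complex^'t^'m \<Rightarrow> complex^'m^'m \<Rightarrow> complex^'n^'t \<Rightarrow> real^'n^'n \<Rightarrow> bool" where
  "optimal_digital_factors H R V \<Phi> \<longleftrightarrow>
     leading_eigenvectors (ctranspose H ** matrix_inv R ** H) V \<and>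
     diagonal \<Phi> \<and> (\<forall>i. 0 \<le> \<Phi> $ i $ i) \<and>
     (\<forall>T. unitary T \<longrightarrow> optimal_precoder H R (V ** cmat \<Phi> ** T))"

text \<open>The parameter \<open>u\<close> is the value at zero.\<close>

definition ph :: "complex \<Rightarrow> complex \<Rightarrow> complex" where
  "ph u a = (if a = 0 then u else a / complex_of_real (cmod a))"

definition l0 :: "complex^'t \<Rightarrow> nat" where
  "l0 x = card {i. x $ i \<noteq> 0}"

datatype ('t, 'n) scheme =
    S1
  | S2
  | S3
  | S4 nat "'n \<Rightarrow> 't set"
  | S5 nat

fun valid_scheme :: "('t::finite, 'n::finite) scheme \<Rightarrow> bool" where
  "valid_scheme (S4 G S) \<longleftrightarrow> (\<forall>j. card (S j) = G)"
| "valid_scheme (S5 G) \<longleftrightarrow> 1 \<le> G \<and> G \<le> CARD('t)"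
| "valid_scheme _ \<longleftrightarrow> True"

fun feasible :: "('t::finite, 'n::finite) scheme \<Rightarrow> (complex^'n^'t) set" where
  "feasible S1 = {W. \<forall>i j. cmod (W $ i $ j) \<in> {0, 1}}"
| "feasible S2 = {W. \<forall>i j. cmod (W $ i $ j) = 1}"
| "feasible S3 = {W. (\<forall>i j. W $ i $ j \<in> {0, 1}) \<and> (\<forall>j. l0 (column j W) = 1)}"
| "feasible (S4 G S) =
     {W. \<forall>i j. (i \<in> S j \<longrightarrow> cmod (W $ i $ j) = 1) \<and> (i \<notin> S j \<longrightarrow> W $ i $ j = 0)}"
| "feasible (S5 G) = {W. (\<forall>i j. cmod (W $ i $ j) \<in> {0, 1}) \<and> (\<forall>j. l0 (column j W) = G)}"

text \<open>
  \<open>scheme_map u s P\<close>: \<open>P\<close> is a version of the map associated with the scheme \<open>s\<close>. Tie-breaking in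
  \<open>S3\<close> and \<open>S5\<close> is left open, so that \<open>P\<close> is not determined uniquely.
\<close>

fun scheme_map ::
  "complex \<Rightarrow> ('t::finite, 'n::finite) scheme \<Rightarrow> (complex^'n^'t \<Rightarrow> complex^'n^'t) \<Rightarrow> bool" where
  "scheme_map u S1 P \<longleftrightarrow>
     (\<forall>A i l. P A $ i $ l = (if 1/2 \<le> cmod (A $ i $ l) then ph u (A $ i $ l) else 0))"
| "scheme_map u S2 P \<longleftrightarrow> (\<forall>A i l. P A $ i $ l = ph u (A $ i $ l))"
| "scheme_map u S3 P \<longleftrightarrow>
     (\<forall>A j. \<exists>m. (\<forall>i. cmod (A $ i $ j) \<le> cmod (A $ m $ j)) \<and>
                (\<forall>i. P A $ i $ j = (if i = m then 1 else 0)))"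
| "scheme_map u (S4 G S) P \<longleftrightarrow>
     (\<forall>A i j. P A $ i $ j = (if i \<in> S j then ph u (A $ i $ j) else 0))"
| "scheme_map u (S5 G) P \<longleftrightarrow>
     (\<forall>A j. \<exists>J. card J = G \<and>
                (\<forall>m\<in>J. \<forall>i. i \<notin> J \<longrightarrow> cmod (A $ i $ j) \<le> cmod (A $ m $ j)) \<and>
                (\<forall>i. P A $ i $ j = (if i \<in> J then ph u (A $ i $ j) else 0)))"

text \<open>
  \<open>magiq_run P B k F T\<close>: the sequences \<open>F\<close> and \<open>T\<close> record \<open>k\<close> iterations of the algorithm on input
  \<open>B\<close>; \<open>F i\<close> and \<open>T i\<close> are the values computed in iteration \<open>i\<close>, for \<open>1 \<le> i \<le> k\<close>, and \<open>T 0\<close> is the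
  initial value.
\<close>

definition magiq_run ::
  "(complex^'n^'t \<Rightarrow> complex^'n^'t) \<Rightarrow> complex^'n^'t \<Rightarrow> nat \<Rightarrow>
   (nat \<Rightarrow> complex^'n^'t) \<Rightarrow> (nat \<Rightarrow> complex^'n^'n) \<Rightarrow> bool" where
  "magiq_run P B k F T \<longleftrightarrow>
     T 0 = mat 1 \<and>
     (\<forall>i<k. F (Suc i) = P (B ** T i) \<and>
        (\<exists>U L W. svd (ctranspose (F (Suc i)) ** B) U L W \<and>
                 T (Suc i) = W ** ctranspose U))"

definition baseband ::
  "complex^'n^'t \<Rightarrow> complex^'n^'t \<Rightarrow> complex^'n^'n \<Rightarrow> complex^'n^'n" where
  "baseband B F T = matrix_inv (ctranspose F ** F) ** ctranspose F ** B ** T"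

definition magiq_output ::
  "complex^'n^'t \<Rightarrow> nat \<Rightarrow> (nat \<Rightarrow> complex^'n^'t) \<Rightarrow> (nat \<Rightarrow> complex^'n^'n) \<Rightarrow> complex^'n^'t" where
  "magiq_output B k F T = F k ** baseband B (F k) (T k)"

end

theory Submission
  imports Defs
begin

text \<open>
  If \<open>V ** cmat \<Psi>\<close> is feasible, then \<open>V ** cmat \<Phi>\<close> is obtained from it by rescaling the columns
  with positive factors, a rescaling that the scheme map undoes; in \<open>S1\<close> a column scaled below the
  threshold would be mapped to zero, which full column rank excludes. Hence the first iteration finds
  \<open>F = V ** cmat \<Psi>\<close>, and the matrix whose singular value decomposition is computed is the positive
  diagonal matrix \<open>\<Psi> ** \<Phi>\<close>. Its unitary polar factor is the identity, so that \<open>T\<close> remains the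
  identity and every later iteration repeats the first one.
\<close>

section \<open>Phases, conjugate transposes and diagonal matrices\<close>

lemma ph_scaled:
  assumes "0 < c" "cmod w = 1"
  shows "ph u (complex_of_real c * w) = w"
  using assms by (auto simp: ph_def norm_mult)

lemma ctranspose_mult: "ctranspose (A ** B) = ctranspose B ** ctranspose A"
  by (simp add: ctranspose_def matrix_matrix_mult_def vec_eq_iff mult.commute)

lemma ctranspose_ctranspose [simp]: "ctranspose (ctranspose A) = A"
  by (simp add: ctranspose_def vec_eq_iff)

lemma cmat_mult: "cmat (A ** B) = cmat A ** cmat B"
  by (simp add: cmat_def vec_eq_iff matrix_matrix_mult_def)

lemma ctranspose_cmat_diagonal: "diagonal D \<Longrightarrow> ctranspose (cmat D) = cmat D"
  by (auto simp: diagonal_def ctranspose_def cmat_def vec_eq_iff) (metis (full_types))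

lemma mult_diagonal:
  fixes A :: "'a::semiring_1^'n^'m"
  assumes "diagonal D"
  shows "(A ** D) $ i $ j = A $ i $ j * D $ j $ j"
proof -
  have "(A ** D) $ i $ j = (\<Sum>k\<in>UNIV. A $ i $ k * D $ k $ j)"
    by (simp add: matrix_matrix_mult_def)
  also have "\<dots> = (\<Sum>k\<in>UNIV. if k = j then A $ i $ j * D $ j $ j else 0)"
    using assms by (intro sum.cong) (auto simp: diagonal_def)
  finally show ?thesis by simp
qed

lemma diagonal_mult: "diagonal A \<Longrightarrow> diagonal B \<Longrightarrow> diagonal (A ** B)"
  for A B :: "'a::semiring_1^'n^'n"
  by (simp add: diagonal_def mult_diagonal[unfolded diagonal_def])

lemma diagonal_cmat: "diagonal D \<Longrightarrow> diagonal (cmat D)"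
  by (simp add: diagonal_def cmat_def)

lemma mult_cmat_diagonal:
  "diagonal D \<Longrightarrow> (A ** cmat D) $ i $ j = complex_of_real (D $ j $ j) * A $ i $ j"
  by (simp add: mult_diagonal diagonal_cmat) (simp add: cmat_def mult.commute)

text \<open>The quadratic form evaluated at the unit vector \<open>axis i 1\<close> is the
  \<open>i\<close>-th diagonal entry.\<close>

lemma posdef_cmat_diagonal_pos:
  fixes D :: "real^'n^'n"
  assumes "posdef (cmat D)"
  shows "0 < D $ i $ i"
proof -
  have "axis i 1 \<noteq> (0::complex^'n)"
    by simp
  then have "0 < Re (\<Sum>k\<in>UNIV. cnj (axis i 1 $ k) * (cmat D *v axis i 1) $ k)"
    using assms unfolding posdef_def by blast
  also have "(\<Sum>k\<in>UNIV. cnj (axis i 1 $ k) * (cmat D *v axis i 1) $ k)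
      = (\<Sum>k\<in>UNIV. if k = i then cmat D $ i $ i else 0)"
    by (intro sum.cong)
      (auto simp: axis_def matrix_vector_mult_def if_distrib[of "(*) _"] cong: if_cong)
  finally show ?thesis
    by (simp add: cmat_def)
qed

section \<open>Inverses and column rank\<close>

text \<open>\<open>matrix_inv\<close> is a Hilbert choice; it is pinned down because two-sided
  inverses are unique.\<close>

lemma matrix_inv_unique:
  fixes A B :: "'a::semiring_1^'n^'n"
  assumes "A ** B = mat 1" "B ** A = mat 1"
  shows "matrix_inv A = B"
proof -
  have "A ** matrix_inv A = mat 1 \<and> matrix_inv A ** A = mat 1"
    unfolding matrix_inv_def
    by (rule someI[of "\<lambda>X. A ** X = mat 1 \<and> X ** A = mat 1" B]) (simp add: assms)
  then have "matrix_inv A = B ** A ** matrix_inv A" and "B ** (A ** matrix_inv A) = B"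
    using assms(2) by simp_all
  then show ?thesis
    by (simp add: matrix_mul_assoc)
qed

lemma positive_diagonal_inverse:
  fixes D :: "real^'n^'n"
  assumes "diagonal D" "\<And>i. 0 < D $ i $ i"
  obtains E where "cmat D ** E = mat 1" "E ** cmat D = mat 1"
proof
  let ?E = "\<chi> i j. if i = j then complex_of_real (1 / D $ i $ i) else 0"
  have nz: "D $ i $ i \<noteq> 0" for i
    using assms(2)[of i] by simp
  show *: "?E ** cmat D = mat 1"
    using nz by (auto simp: vec_eq_iff mult_cmat_diagonal[OF assms(1)] mat_def)
  then show "cmat D ** ?E = mat 1"
    by (simp add: matrix_left_right_inverse)
qed

text \<open>Full column rank provides a left inverse \<open>B\<close>, and a zero column
  \<open>j\<close> of \<open>A\<close> would make the entry of \<open>B ** A\<close> at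
  \<open>j\<close>, \<open>j\<close> zero instead of 1.\<close>

lemma full_rank_column_nonzero:
  fixes A :: "'a::field^'n^'m"
  assumes "rank A = CARD('n)"
  obtains i where "A $ i $ j \<noteq> 0"
proof -
  have "vec.span (rows A) = UNIV"
    using assms by (metis row_rank_def_gen vec.dim_eq_full vec.span_UNIV vec_dim_card)
  then obtain B where "B ** A = mat 1"
    using matrix_left_invertible_span_rows_gen by blast
  then have "(\<Sum>k\<in>UNIV. B $ j $ k * A $ k $ j) = 1"
    by (simp add: vec_eq_iff matrix_matrix_mult_def mat_def)
  then have "\<exists>k. A $ k $ j \<noteq> 0"
    by (metis (no_types, lifting) mult_zero_right sum.neutral zero_neq_one)
  with that show ?thesis by blast
qed

section \<open>Unitary matrices and the polar factor of a positive diagonal matrix\<close>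

lemma unitary_mult: "unitary A \<Longrightarrow> unitary B \<Longrightarrow> unitary (A ** B)"
  unfolding unitary_def ctranspose_mult
  by (metis matrix_mul_assoc matrix_mul_lid)

lemma unitary_ctranspose: "unitary A \<Longrightarrow> unitary (ctranspose A)"
  by (simp add: unitary_def)

lemma unitary_row_norm:
  assumes "unitary U"
  shows "(\<Sum>j\<in>UNIV. (cmod (U $ i $ j))\<^sup>2) = 1"
proof -
  have "complex_of_real (\<Sum>j\<in>UNIV. (cmod (U $ i $ j))\<^sup>2) = (U ** ctranspose U) $ i $ i"
    by (simp only: of_real_sum complex_norm_square) (simp add: matrix_matrix_mult_def ctranspose_def)
  also have "\<dots> = 1"
    using assms by (simp add: unitary_def mat_def)
  finally show ?thesis
    using of_real_eq_1_iff by blast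
qed

lemma unitary_entry_le_1:
  assumes "unitary U"
  shows "cmod (U $ i $ j) \<le> 1"
proof -
  have "(cmod (U $ i $ j))\<^sup>2 \<le> (\<Sum>j\<in>UNIV. (cmod (U $ i $ j))\<^sup>2)"
    by (intro member_le_sum) auto
  then show ?thesis
    by (simp add: unitary_row_norm[OF assms] power_le_one_iff abs_square_le_1)
qed

text \<open>Entries of a unitary matrix have modulus at most 1, so real part 1 leaves no imaginary
  part. Each diagonal entry then exhausts the unit norm of its row.\<close>

lemma unitary_diagonal_Re_1:
  assumes "unitary U" "\<And>i. Re (U $ i $ i) = 1"
  shows "U = mat 1"
proof -
  have diag: "U $ i $ i = 1" for i
  proof -
    have "(Re (U $ i $ i))\<^sup>2 + (Im (U $ i $ i))\<^sup>2 \<le> 1"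
      using unitary_entry_le_1[OF assms(1), of i i]
      by (metis cmod_power2 norm_ge_zero power_le_one)
    then show ?thesis
      by (simp add: assms(2) complex_eq_iff)
  qed
  have "U $ i $ j = 0" if "i \<noteq> j" for i j
  proof -
    have "(\<Sum>k\<in>UNIV - {i}. (cmod (U $ i $ k))\<^sup>2) = 0"
      using unitary_row_norm[OF assms(1), of i] diag[of i]
      by (simp add: sum.remove[of UNIV i])
    then show ?thesis
      using that by (subst (asm) sum_nonneg_eq_0_iff) auto
  qed
  with diag show ?thesis
    by (simp add: vec_eq_iff mat_def)
qed

lemma svd_positive_diagonal:
  assumes svd: "svd (cmat D) U L W"
    and D: "diagonal D" "\<And>i. 0 < D $ i $ i"
  shows "W ** ctranspose U = mat 1"
proof -
  from svd have U: "unitary U" and W: "unitary W" and L: "diagonal L" "\<And>i. 0 \<le> L $ i $ i"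
    and eq: "cmat D = U ** cmat L ** ctranspose W"
    by (auto simp: svd_def)
  let ?T = "W ** ctranspose U" and ?M = "ctranspose W ** U"
  have T: "unitary ?T" and M: "unitary ?M"
    using U W by (simp_all add: unitary_mult unitary_ctranspose)
  \<comment> \<open>By von Neumann's trace inequality the unitary polar factor attains the maximum of
    \<open>Re (trace (T ** D))\<close> over unitary \<open>T\<close>; for a positive diagonal matrix the identity is the
    only maximizer.\<close>
  have "trace (cmat D) = trace (ctranspose W ** (U ** cmat L))"
    unfolding eq by (rule trace_mul_sym)
  also have "\<dots> = trace (?M ** cmat L)"
    by (simp add: matrix_mul_assoc)
  finally have "(\<Sum>i\<in>UNIV. D $ i $ i) = (\<Sum>i\<in>UNIV. L $ i $ i * Re (?M $ i $ i))"
    by (simp add: trace_def mult_cmat_diagonal[OF L(1)] complex_eq_iff) (simp add: cmat_def)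
  also have "\<dots> \<le> (\<Sum>i\<in>UNIV. L $ i $ i)"
    using L(2) unitary_entry_le_1[OF M] complex_Re_le_cmod order_trans
    by (intro sum_mono mult_left_le) blast+
  also have "\<dots> = (\<Sum>i\<in>UNIV. D $ i $ i * Re (?T $ i $ i))"
  proof -
    \<comment> \<open>The two inserted products are identities; moving the last \<open>U\<close> to
      the front by cyclicity completes the factorization of \<open>cmat D\<close>.\<close>
    have "trace (cmat L) = trace (cmat L ** (ctranspose W ** W) ** (ctranspose U ** U))"
      using U W by (simp add: unitary_def)
    also have "\<dots> = trace ((cmat L ** ctranspose W ** W ** ctranspose U) ** U)"
      by (simp add: matrix_mul_assoc)
    also have "\<dots> = trace (cmat D ** ?T)"
      unfolding eq by (subst trace_mul_sym) (simp add: matrix_mul_assoc)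
    also have "\<dots> = trace (?T ** cmat D)"
      by (rule trace_mul_sym)
    finally show ?thesis
      by (simp add: trace_def mult_cmat_diagonal[OF D(1)] complex_eq_iff) (simp add: cmat_def)
  qed
  \<comment> \<open>The chain bounds the trace of \<open>D\<close> by the real part of the trace of
    \<open>?T ** cmat D\<close>. Since no diagonal entry of \<open>?T\<close> has real part above 1,
    all summands are nonnegative and must vanish.\<close>
  finally have "(\<Sum>i\<in>UNIV. D $ i $ i * (1 - Re (?T $ i $ i))) \<le> 0"
    by (simp add: right_diff_distrib sum_subtractf)
  moreover have nonneg: "0 \<le> D $ i $ i * (1 - Re (?T $ i $ i))" for i
    using D(2)[of i] complex_Re_le_cmod[of "?T $ i $ i"] unitary_entry_le_1[OF T, of i i] by simp
  ultimately have "(\<Sum>i\<in>UNIV. D $ i $ i * (1 - Re (?T $ i $ i))) = 0"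
    by (meson antisym sum_nonneg)
  then have "D $ i $ i * (1 - Re (?T $ i $ i)) = 0" for i
    using nonneg by (subst (asm) sum_nonneg_eq_0_iff) auto
  then have "Re (?T $ i $ i) = 1" for i
    using D(2)[of i] by (metis eq_iff_diff_eq_0 less_irrefl mult_eq_0_iff)
  then show ?thesis
    by (rule unitary_diagonal_Re_1[OF T])
qed

section \<open>The eigenvector matrix and the scheme maps\<close>

lemma leading_eigenvectors_orthonormal:
  assumes "leading_eigenvectors A V"
  shows "ctranspose V ** V = mat 1"
proof -
  from assms obtain U \<sigma> where U: "unitary U" and \<sigma>: "inj \<sigma>"
    and col: "\<And>j. column j V = column (\<sigma> j) U"
    unfolding leading_eigenvectors_def by blast
  have entry: "V $ i $ j = U $ i $ \<sigma> j" for i j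
    using col[of j] by (simp add: column_def vec_eq_iff)
  have "(ctranspose V ** V) $ i $ j = (ctranspose U ** U) $ \<sigma> i $ \<sigma> j" for i j
    by (simp add: matrix_matrix_mult_def ctranspose_def entry)
  then show ?thesis
    using U \<sigma> by (simp add: unitary_def vec_eq_iff mat_def inj_eq)
qed

text \<open>Positive column factors preserve phases and zeros. Nonzero entries of a feasible matrix
  have modulus 1, so those in column \<open>j\<close> of \<open>A\<close> all have modulus
  \<open>c j\<close>: selecting the largest recovers the support of \<open>W\<close>, and the
  threshold in \<open>S1\<close> keeps all of them or none. The premise \<open>nonzero\<close> rules
  out none.\<close>

lemma scheme_map_scaled_feasible:
  fixes A W :: "complex^'n^'t"
  assumes P: "scheme_map u s P" and W: "W \<in> feasible s"
    and scaled: "\<And>i j. A $ i $ j = complex_of_real (c j) * W $ i $ j"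
    and c: "\<And>j. 0 < c j"
    and nonzero: "\<And>j. \<exists>i. P A $ i $ j \<noteq> 0"
  shows "P A = W"
proof -
  have cmodA: "cmod (A $ i $ j) = c j * cmod (W $ i $ j)" for i j
    using c[of j] by (simp add: scaled norm_mult)
  have phA: "cmod (W $ i $ j) = 1 \<Longrightarrow> ph u (A $ i $ j) = W $ i $ j" for i j
    by (simp add: scaled ph_scaled c)
  have "P A $ i $ j = W $ i $ j" for i j
  proof (cases s)
    case S1
    then have W01: "cmod (W $ i $ j) \<in> {0, 1}" for i
      using W by simp
    have PA: "P A $ i $ j = (if 1/2 \<le> cmod (A $ i $ j) then ph u (A $ i $ j) else 0)" for i
      using P S1 by simp
    from nonzero[of j] obtain i' where "1/2 \<le> cmod (A $ i' $ j)"
      unfolding PA by (auto split: if_splits)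
    then have "1/2 \<le> c j"
      using W01[of i'] by (auto simp: cmodA)
    then show ?thesis
      using W01[of i] phA[of i j] by (auto simp: PA cmodA)
  next
    case S2
    then show ?thesis
      using P W phA by simp
  next
    case S3
    then have "l0 (column j W) = 1" and W01: "\<And>i. W $ i $ j \<in> {0, 1}"
      using W by simp_all
    then obtain m where "{i. column j W $ i \<noteq> 0} = {m}"
      unfolding l0_def by (metis card_1_singletonE)
    then have m: "W $ i $ j \<noteq> 0 \<longleftrightarrow> i = m" for i
      by (auto simp: column_def set_eq_iff)
    from P S3 obtain m' where max: "\<And>i. cmod (A $ i $ j) \<le> cmod (A $ m' $ j)"
      and PA: "\<And>i. P A $ i $ j = (if i = m' then 1 else 0)"
      by simp metis
    \<comment> \<open>Column \<open>j\<close> of \<open>A\<close> is nonzero exactly at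
      \<open>m\<close>, so its maximum can be attained nowhere else.\<close>
    have "m' = m"
      using max[of m] c[of j] m[of m] m[of m'] by (auto simp: cmodA)
    then show ?thesis
      using W01[of i] m[of i] PA[of i] by auto
  next
    case (S4 G S)
    then show ?thesis
      using P W phA[of i j] by simp
  next
    case (S5 G)
    then have W01: "cmod (W $ i $ j) \<in> {0, 1}" for i
      using W by simp
    define K where "K = {i. W $ i $ j \<noteq> 0}"
    have "card K = G"
      using S5 W by (simp add: l0_def column_def K_def)
    from P S5 obtain J where J: "card J = G"
      and max: "\<And>m i. m \<in> J \<Longrightarrow> i \<notin> J \<Longrightarrow> cmod (A $ i $ j) \<le> cmod (A $ m $ j)"
      and PA: "\<And>i. P A $ i $ j = (if i \<in> J then ph u (A $ i $ j) else 0)"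
      by simp metis
    \<comment> \<open>If \<open>J\<close> contained a zero position of \<open>W\<close>, maximality
      would force zeros everywhere outside \<open>J\<close>, hence \<open>K \<subseteq> J\<close>;
      equal cardinalities then give \<open>K = J\<close>, a contradiction. Thus ties cannot affect
      the choice.\<close>
    have "J \<subseteq> K"
    proof (rule ccontr)
      assume "\<not> J \<subseteq> K"
      then obtain m where m: "m \<in> J" "W $ m $ j = 0"
        by (auto simp: K_def)
      have "K \<subseteq> J"
      proof
        fix i assume "i \<in> K"
        with max[OF m(1), of i] m(2) c[of j] show "i \<in> J"
          by (auto simp: cmodA K_def mult_le_0_iff)
      qed
      then have "K = J"
        using J \<open>card K = G\<close> by (intro card_subset_eq) auto
      with \<open>\<not> J \<subseteq> K\<close> show False by simp
    qed
    then have "J = K"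
      using J \<open>card K = G\<close> by (intro card_subset_eq) auto
    then show ?thesis
      using W01[of i] phA[of i j] by (auto simp: PA K_def)
  qed
  then show ?thesis
    by (simp add: vec_eq_iff)
qed

section \<open>The iteration and its output\<close>

theorem proposition1:
  fixes H :: "complex^'t^'m"
    and R :: "complex^'m^'m"
    and V :: "complex^'n^'t"
    and \<Phi> \<Psi> :: "real^'n^'n"
    and s :: "('t, 'n) scheme"
    and u :: complex
    and P :: "complex^'n^'t \<Rightarrow> complex^'n^'t"
    and k :: nat
    and F_RF :: "nat \<Rightarrow> complex^'n^'t"
    and T :: "nat \<Rightarrow> complex^'n^'n"
  assumes "CARD('n) \<le> CARD('t)"
    and "posdef R"
    and "optimal_digital_factors H R V \<Phi>"
    and "\<forall>i. 0 < \<Phi> $ i $ i"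
    and "valid_scheme s"
    and "cmod u = 1"
    and "scheme_map u s P"
    and "1 \<le> k"
    and "magiq_run P (V ** cmat \<Phi>) k F_RF T"
    and "\<forall>i\<in>{1..k}. rank (F_RF i) = CARD('n)"
    and "diagonal \<Psi>"
    and "posdef (cmat \<Psi>)"
    and "V ** cmat \<Psi> \<in> feasible s"
  shows "magiq_output (V ** cmat \<Phi>) k F_RF T = V ** cmat \<Phi>"
proof -
  let ?B = "V ** cmat \<Phi>" and ?C = "cmat \<Psi>"
  let ?W = "V ** ?C"
  have V: "ctranspose V ** V = mat 1" and \<Phi>: "diagonal \<Phi>"
    using assms(3) leading_eigenvectors_orthonormal unfolding optimal_digital_factors_def by blast+
  have \<Psi>: "0 < \<Psi> $ i $ i" for i
    using assms(12) by (rule posdef_cmat_diagonal_pos)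
  \<comment> \<open>The orthonormal columns of \<open>V\<close> cancel. Taking \<open>A\<close> as
    \<open>cmat \<Phi>\<close> gives the matrix to be decomposed, as \<open>?C\<close> the Gram
    matrix of \<open>?W\<close>.\<close>
  have gram: "ctranspose ?W ** (V ** A) = ?C ** A" for A
    by (metis V assms(11) ctranspose_cmat_diagonal ctranspose_mult matrix_mul_assoc matrix_mul_rid)
  have scaled: "?B $ i $ j = complex_of_real (\<Phi> $ j $ j / \<Psi> $ j $ j) * ?W $ i $ j" for i j
    using \<Psi>[of j] by (simp add: mult_cmat_diagonal \<Phi> assms(11))
  have D: "diagonal (\<Psi> ** \<Phi>)" "0 < (\<Psi> ** \<Phi>) $ i $ i" for i
    using \<Phi> \<Psi> assms(4,11) by (simp_all add: diagonal_mult mult_diagonal)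
  have step: "F_RF (Suc i) = ?W \<and> T (Suc i) = mat 1" if "i < k" "T i = mat 1" for i
  proof -
    from assms(9) that obtain U L X where F: "F_RF (Suc i) = P ?B"
      and svd: "svd (ctranspose (F_RF (Suc i)) ** ?B) U L X"
      and T: "T (Suc i) = X ** ctranspose U"
      unfolding magiq_run_def by (metis matrix_mul_rid)
    \<comment> \<open>Full column rank supplies the nonzero entry in each column that settles the
      threshold in \<open>S1\<close>.\<close>
    have "rank (P ?B) = CARD('n)"
      using assms(10) that F by (metis Suc_leI atLeastAtMost_iff le_add1 plus_1_eq_Suc)
    then have "\<exists>i. P ?B $ i $ j \<noteq> 0" for j
      by (metis full_rank_column_nonzero)
    then have "P ?B = ?W"
      using \<Psi> assms(4) scheme_map_scaled_feasible[OF assms(7,13) scaled] by simp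
    moreover from this svd have "svd (cmat (\<Psi> ** \<Phi>)) U L X"
      by (simp add: F gram cmat_mult)
    then have "T (Suc i) = mat 1"
      unfolding T using D by (rule svd_positive_diagonal)
    ultimately show ?thesis
      using F by simp
  qed
  have T_id: "i \<le> k \<Longrightarrow> T i = mat 1" for i
  proof (induction i)
    case 0
    then show ?case
      using assms(9) by (simp add: magiq_run_def)
  next
    case (Suc i)
    then show ?case
      using step by simp
  qed
  \<comment> \<open>As \<open>k\<close> is at least 1, the final \<open>F_RF k\<close> comes from an
    actual iteration, entered with \<open>T k'\<close> equal to the identity.\<close>
  obtain k' where "k = Suc k'"
    using assms(8) by (cases k) auto
  with step[of k'] T_id[of k'] have Fk: "F_RF k = ?W" and Tk: "T k = mat 1"
    by simp_all
  obtain E where E: "?C ** E = mat 1" "E ** ?C = mat 1"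
    using positive_diagonal_inverse assms(11) \<Psi> by blast
  \<comment> \<open>The Gram matrix of \<open>?W\<close> is \<open>?C ** ?C\<close>, so the baseband
    factor reduces to \<open>E ** cmat \<Phi>\<close>, whose \<open>E\<close> cancels the
    \<open>?C\<close> in \<open>?W\<close>.\<close>
  have "matrix_inv (?C ** ?C) = E ** E"
    by (rule matrix_inv_unique) (metis E matrix_mul_assoc matrix_mul_rid)+
  then have "baseband ?B ?W (mat 1) = E ** E ** (?C ** cmat \<Phi>)"
    by (simp add: baseband_def gram flip: matrix_mul_assoc)
  also have "\<dots> = E ** cmat \<Phi>"
    by (metis E(2) matrix_mul_assoc matrix_mul_rid)
  finally show ?thesis
    unfolding magiq_output_def Fk Tk by (metis E(1) matrix_mul_assoc matrix_mul_rid)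
qed

end
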